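(* Let $q\in\mathbb{C}^*$ with $0<|q|<1$ and let $\lambda\in\mathbb{C}^*\setminus q^{\mathbb{Z}}$. For any $x\in\mathbb{C}^*\setminus[-\lambda;q]$, \begin{align*} \theta_q(x)\,{}_2f_0\left(0,0;-;q,-\frac{x}{q}\right)&=(q;q)_\infty\frac{\theta_q(x)\,\theta_{q^2}\left(-\frac{\lambda^2}{qx}\right)}{\theta_q\left(-\frac{\lambda}{q}\right)\theta_q\left(\frac{\lambda}{x}\right)}\,{}_1\varphi_1\left(0;q;q^2,\frac{q^2}{x}\right)\\ &\quad+\frac{(q;q)_\infty}{1-q}\,\frac{\theta_q(x)\,\theta_{q^2}\left(-\frac{\lambda^2}{x}\right)}{\theta_q\left(-\frac{\lambda}{q}\right)\theta_q\left(\frac{\lambda}{x}\right)}\,\frac{\lambda}{x}\,{}_1\varphi_1\left(0;q^3;q^2,\frac{q^3}{x}\right), \end{align*} where ${}_2f_0\left(0,0;-;q,-\frac{x}{q}\right)$ denotes the $q$-Borel-Laplace transform of the first kind, $(\mathcal{L}_q^+\circ\mathcal{B}_q^+v)(x)$ (with $\mathcal{L}_q^+$ taken along the spiral $\lambda q^{\mathbb{Z}}$), of the divergent power series $v(x)={}_2\varphi_0\left(0,0;-;q,-\frac{x}{q}\right)$.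
   Context: Throughout $q\in\mathbb{C}^*$ satisfies $0<|q|<1$. The $q$-shifted factorial is $(a;q)_0=1$, $(a;q)_n=(1-a)(1-aq)\cdots(1-aq^{n-1})$ for $n\ge 1$, $(a;q)_\infty=\lim_{n\to\infty}(a;q)_n$, and $(a_1,\dots,a_m;q)_n=(a_1;q)_n\cdots(a_m;q)_n$. The basic hypergeometric series is \[{}_r\varphi_s(a_1,\dots,a_r;b_1,\dots,b_s;q,x)=\sum_{n\ge 0}\frac{(a_1,\dots,a_r;q)_n}{(b_1,\dots,b_s;q)_n(q;q)_n}\left\{(-1)^nq^{\frac{n(n-1)}{2}}\right\}^{1+s-r}x^n .\] In particular, with base $q^2$, ${}_1\varphi_1(0;b;q^2,z)=\sum_{n\ge 0}\frac{(-1)^nq^{n(n-1)}}{(b;q^2)_n(q^2;q^2)_n}z^n$, which converges for all $z$, while \[{}_2\varphi_0\left(0,0;-;q,-\frac{x}{q}\right)=\sum_{n\ge 0}\frac{1}{(q;q)_n}\left\{(-1)^nq^{\frac{n(n-1)}{2}}\right\}^{-1}\left(-\frac{x}{q}\right)^n\] is a divergent (formal) power series in $x$. The theta function of Jacobi with base $p$ ($0<|p|<1$) is $\theta_p(x)=\sum_{n\in\mathbb{Z}}p^{\frac{n(n-1)}{2}}x^n$ for $x\in\mathbb{C}^*$. For $\mu\in\mathbb{C}^*$, $[\mu;q]=\mu q^{\mathbb{Z}}=\{\mu q^k : k\in\mathbb{Z}\}$. The $q$-Borel transformation of the first kind sends a formal power series $f(x)=\sum_{n\ge 0}a_nx^n$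 to $(\mathcal{B}_q^+f)(\xi)=\sum_{n\ge 0}a_nq^{\frac{n(n-1)}{2}}\xi^n$. The $q$-Laplace transformation of the first kind along $\lambda q^{\mathbb{Z}}$ sends a function $\varphi$ to \[(\mathcal{L}_q^+\varphi)(x)=\sum_{n\in\mathbb{Z}}\frac{\varphi(\lambda q^n)}{\theta_q\left(\frac{\lambda q^n}{x}\right)} .\] For $v(x)={}_2\varphi_0(0,0;-;q,-x/q)$, the series $(\mathcal{B}_q^+v)(\xi)={}_1\varphi_0(0;-;q,\xi/q)=\sum_{n\ge0}\frac{(\xi/q)^n}{(q;q)_n}$ converges for $|\xi/q|<1$. In $\mathcal{L}_q^+$ the symbol $\varphi$ denotes its meromorphic continuation to $\mathbb{C}$, namely $\varphi(\xi)=\frac{1}{(\xi/q;q)_\infty}$, which is finite at all points $\lambda q^n$ since $\lambda\notin q^{\mathbb{Z}}$. Thus ${}_2f_0\left(0,0;-;q,-\frac{x}{q}\right)=\sum_{n\in\mathbb{Z}}\frac{\varphi(\lambda q^n)}{\theta_q(\lambda q^n/x)}$; the dependence on $\lambda$ is suppressed in the notation. *)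

theory Defs
  imports "HOL-Complex_Analysis.Complex_Analysis"
begin

definition qpoch :: "complex \<Rightarrow> complex \<Rightarrow> nat \<Rightarrow> complex" where
  "qpoch a q n = (\<Prod>k<n. 1 - a * q ^ k)"

definition qpoch_inf :: "complex \<Rightarrow> complex \<Rightarrow> complex" where
  "qpoch_inf a q = lim (\<lambda>n. qpoch a q n)"

definition qpochs :: "complex list \<Rightarrow> complex \<Rightarrow> nat \<Rightarrow> complex" where
  "qpochs as q n = (\<Prod>a\<leftarrow>as. qpoch a q n)"

text \<open>
  The coefficient of \<open>x\<^sup>n\<close> in the basic hypergeometric series with upper parameters \<open>as\<close>,
  lower parameters \<open>bs\<close> and base \<open>q\<close>; the exponent \<open>1 + s - r\<close> is an integer and may be
  negative.
\<close>

definition qhyp_coeff :: "complex list \<Rightarrow> complex list \<Rightarrow> complex \<Rightarrow> nat \<Rightarrow> complex" where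
  "qhyp_coeff as bs q n =
     qpochs as q n / (qpochs bs q n * qpoch q q n) *
     ((-1) ^ n * q ^ (n * (n - 1) div 2)) powi (1 + int (length bs) - int (length as))"

definition qhyp :: "complex list \<Rightarrow> complex list \<Rightarrow> complex \<Rightarrow> complex \<Rightarrow> complex" where
  "qhyp as bs q x = (\<Sum>n. qhyp_coeff as bs q n * x ^ n)"

text \<open>The same series with argument \<open>c * x\<close>, as a formal power series in \<open>x\<close>.\<close>

definition qhyp_fps :: "complex list \<Rightarrow> complex list \<Rightarrow> complex \<Rightarrow> complex \<Rightarrow> complex fps" where
  "qhyp_fps as bs q c = Abs_fps (\<lambda>n. qhyp_coeff as bs q n * c ^ n)"

definition jtheta :: "complex \<Rightarrow> complex \<Rightarrow> complex" where
  "jtheta p x = (\<Sum>\<^sub>\<infinity>n\<in>(UNIV :: int set). p powi (n * (n - 1) div 2) * x powi n)"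

definition qspiral :: "complex \<Rightarrow> complex \<Rightarrow> complex set" where
  "qspiral \<mu> q = {\<mu> * q powi k | k :: int. True}"

definition qborel :: "complex \<Rightarrow> complex fps \<Rightarrow> complex fps" where
  "qborel q F = Abs_fps (\<lambda>n. fps_nth F n * q ^ (n * (n - 1) div 2))"

text \<open>
  The meromorphic function on the whole plane with Taylor expansion \<open>F\<close> at the origin.
  It is unique if it exists: \<open>nicely_meromorphic_on\<close> excludes removable singularities and
  fixes the value 0 at poles. If \<open>F\<close> has radius of convergence 0 or has no such
  continuation, the result is unspecified.
\<close>

definition meromorphic_continuation :: "complex fps \<Rightarrow> complex \<Rightarrow> complex" where
  "meromorphic_continuation F =
     (THE \<phi>. \<phi> nicely_meromorphic_on UNIV \<and> \<phi> has_fps_expansion F)"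

definition qlaplace :: "complex \<Rightarrow> complex \<Rightarrow> (complex \<Rightarrow> complex) \<Rightarrow> complex \<Rightarrow> complex" where
  "qlaplace q \<mu> \<phi> x =
     (\<Sum>\<^sub>\<infinity>n\<in>(UNIV :: int set). \<phi> (\<mu> * q powi n) / jtheta q (\<mu> * q powi n / x))"

definition qborel_laplace :: "complex \<Rightarrow> complex \<Rightarrow> complex fps \<Rightarrow> complex \<Rightarrow> complex" where
  "qborel_laplace q \<mu> F = qlaplace q \<mu> (meromorphic_continuation (qborel q F))"

text \<open>The resummation of \<open>\<^sub>2\<phi>\<^sub>0(0, 0; -; q, -x/q)\<close> along \<open>\<mu> q\<^sup>\<int>\<close>, as a function of \<open>x\<close>.\<close>

definition two_f_zero :: "complex \<Rightarrow> complex \<Rightarrow> complex \<Rightarrow> complex" where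
  "two_f_zero q \<mu> = qborel_laplace q \<mu> (qhyp_fps [0, 0] [] q (- 1 / q))"

end

theory Submission
  imports Defs
begin

text \<open>
  Write \<open>E(z) = (z;q)\<^sub>\<infinity>\<close> and \<open>a = \<lambda>/q\<close>. Euler's expansion of \<open>1/E\<close> shows that the
  continued Borel transform is \<open>1/E(\<xi>/q)\<close>. By the Jacobi triple product and the quasi-periodicity
  of \<open>\<theta>\<close>, the \<open>n\<close>-th term of the Laplace sum equals
  \<open>(q;q)\<^sub>\<infinity> / (\<theta>\<^sub>q(-a) \<theta>\<^sub>q(\<lambda>/x)) q\<^bsup>n(n-1)\<^esup> w\<^bsup>n\<^esup> E(q\<^bsup>1-n\<^esup>/a)\<close> with \<open>w = -\<lambda>\<^sup>2/(qx)\<close>. Expand the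
  last factor by Euler's series in an index \<open>m\<close>. Shifting \<open>n\<close> by \<open>k\<close> when \<open>m = 2k\<close>, and by
  \<open>k + 1\<close> when \<open>m = 2k + 1\<close>, turns each of the two double series into a theta series
  with base \<open>q\<^sup>2\<close> times a \<open>\<^sub>1\<phi>\<^sub>1\<close>. The same shearing, by \<open>-m\<close>, proves the triple product when
  \<open>\<bar>q\<bar> < \<bar>a\<bar>\<close>; the functional equation extends it to all \<open>a \<noteq> 0\<close>.
\<close>

subsection \<open>Ratio test\<close>

text \<open>All series below come with an explicit ratio of consecutive terms. Its limit is 0 for
  theta, Euler and \<open>qhyp\<close> series and \<open>z\<close> for the power series of
  \<open>1/E(z)\<close>.\<close>

lemma summable_norm_ratio:
  fixes f :: "nat \<Rightarrow> 'a :: real_normed_div_algebra"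
  assumes rec: "\<And>n. f (Suc n) = r n * f n" and lim: "r \<longlonglongrightarrow> c" and c: "norm c < 1"
  shows "summable (\<lambda>n. norm (f n))"
proof -
  obtain d where d: "norm c < d" "d < 1" using c dense by blast
  have "(\<lambda>n. norm (r n)) \<longlonglongrightarrow> norm c" by (intro tendsto_norm lim)
  then have "\<forall>\<^sub>F n in sequentially. norm (r n) < d" using d by (intro order_tendstoD)
  then obtain N where N: "\<And>n. n \<ge> N \<Longrightarrow> norm (r n) < d"
    by (auto simp: eventually_sequentially)
  show ?thesis
  proof (rule summable_ratio_test[OF d(2)])
    fix n assume "n \<ge> N"
    then show "norm (norm (f (Suc n))) \<le> d * norm (norm (f n))"
      using N[of n] by (simp add: rec norm_mult mult_right_mono)
  qed
qed

subsection \<open>Meromorphic continuation\<close>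

text \<open>Identity theorem: the difference vanishes off a sparse set or is nonzero off a sparse
  set, and agreement near \<open>z0\<close> excludes the latter. The normalisation at poles then
  gives equality at every point.\<close>

lemma nicely_meromorphic_unique:
  assumes f: "f nicely_meromorphic_on A" and g: "g nicely_meromorphic_on A"
    and A: "open A" "connected A" and z0: "z0 \<in> A" and eq: "\<forall>\<^sub>F z in at z0. f z = g z"
    and z: "z \<in> A"
  shows "f z = g z"
proof -
  have "(\<lambda>z. f z - g z) meromorphic_on A"
    using f g unfolding nicely_meromorphic_on_def by (intro meromorphic_intros) auto
  then have "(\<forall>\<^sub>\<approx>z\<in>A. f z - g z = 0) \<or> (\<forall>\<^sub>\<approx>z\<in>A. f z - g z \<noteq> 0)"
    using A by (rule meromorphic_imp_constant_or_avoid)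
  moreover have "\<not> (\<forall>\<^sub>\<approx>z\<in>A. f z - g z \<noteq> 0)"
  proof
    assume "\<forall>\<^sub>\<approx>z\<in>A. f z - g z \<noteq> 0"
    then have "\<forall>\<^sub>F z in at z0. f z - g z \<noteq> 0"
      using z0 A by (simp add: eventually_cosparse_open_eq)
    with eq have "\<forall>\<^sub>F z in at z0. False" by eventually_elim auto
    then show False by simp
  qed
  ultimately have ev: "\<forall>\<^sub>F w in at z. f w = g w"
    using z A by (auto simp: eventually_cosparse_open_eq)
  \<comment> \<open>Agreement is so far known only on a punctured neighbourhood of \<open>z\<close>.
    At a common pole both values are 0; otherwise both values are the common limit.\<close>
  have pole: "is_pole f z \<longleftrightarrow> is_pole g z"
    by (rule is_pole_cong[OF ev refl])
  have lim: "f \<midarrow>z\<rightarrow> c \<longleftrightarrow> g \<midarrow>z\<rightarrow> c" for c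
    by (rule tendsto_cong[OF ev])
  show ?thesis
  proof (cases "is_pole f z")
    case True
    then show ?thesis
      using pole f g z is_pole_zero_at_nicely_mero by metis
  next
    case False
    then have "f \<midarrow>z\<rightarrow> f z" "g \<midarrow>z\<rightarrow> g z"
      using pole f g z unfolding nicely_meromorphic_on_def by blast+
    then show ?thesis using lim LIM_unique by blast
  qed
qed

lemma meromorphic_continuation_eqI:
  assumes "f nicely_meromorphic_on UNIV" "f has_fps_expansion F"
  shows "meromorphic_continuation F = f"
  unfolding meromorphic_continuation_def
proof (rule the_equality)
  fix g assume g: "g nicely_meromorphic_on UNIV \<and> g has_fps_expansion F"
  have "\<forall>\<^sub>F z in nhds 0. g z = f z"
    using g assms(2) unfolding has_fps_expansion_def
    by (auto elim: eventually_elim2)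
  then have "\<forall>\<^sub>F z in at 0. g z = f z"
    by (rule filter_leD[OF at_within_le_nhds])
  then show "g = f"
    using nicely_meromorphic_unique[of g UNIV f 0] g assms(1) by auto
qed (use assms in auto)

subsection \<open>Theta functions\<close>

definition theta_term :: "complex \<Rightarrow> complex \<Rightarrow> int \<Rightarrow> complex" where
  "theta_term p x n = p powi (n * (n - 1) div 2) * x powi n"

lemma jtheta_eq: "jtheta p x = infsum (theta_term p x) UNIV"
  by (simp add: jtheta_def theta_term_def[abs_def])

lemma triangle_add:
  fixes m n :: int
  shows "(m + n) * (m + n - 1) div 2 = m * (m - 1) div 2 + n * (n - 1) div 2 + m * n"
proof -
  obtain a b where a: "m * (m - 1) = 2 * a" and b: "n * (n - 1) = 2 * b"
    by (metis even_mult_iff odd_even_add diff_add_cancel odd_one dvdE)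
  have "(m + n) * (m + n - 1) = 2 * (a + b + m * n)"
    using a b by (simp add: algebra_simps)
  then show ?thesis by (simp only: a b) simp
qed

lemma triangle_int: "int n * (int n - 1) div 2 = int (n * (n - 1) div 2)"
proof -
  have "int n * (int n - 1) = int (n * (n - 1))"
    by (cases n) (auto simp: algebra_simps)
  then show ?thesis by (simp only: zdiv_int of_nat_numeral)
qed

lemma triangle_double_int: "int (k * (k - 1)) = int k * (int k - 1)"
  by (cases k) (auto simp: algebra_simps)

lemma theta_term_nonzero: "p \<noteq> 0 \<Longrightarrow> x \<noteq> 0 \<Longrightarrow> theta_term p x n \<noteq> 0"
  by (simp add: theta_term_def)

text \<open>The cross factor \<open>p powi (m * n)\<close> is the source of quasi-periodicity and of
  the cancellations in the shears below.\<close>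

lemma theta_term_add:
  assumes "p \<noteq> 0" "x \<noteq> 0"
  shows "theta_term p x (m + n) = theta_term p x m * theta_term p x n * p powi (m * n)"
  using assms by (simp add: theta_term_def triangle_add power_int_add mult_ac)

lemma theta_term_scale: "theta_term p (x * y) n = theta_term p x n * y powi n"
  by (simp add: theta_term_def power_int_mult_distrib)

text \<open>This is where base \<open>q^2\<close> enters: one base-\<open>q\<close> factor will come
  from the triple product, the other from the Laplace kernel.\<close>

lemma theta_term_mult:
  assumes "p \<noteq> 0"
  shows "theta_term p x n * theta_term p y n = theta_term (p\<^sup>2) (x * y) n"
  by (simp add: theta_term_def power_int_mult_distrib power2_eq_square mult_ac)

lemma theta_term_square: "theta_term (p\<^sup>2) x n = p powi (n * (n - 1)) * x powi n"
proof -
  have "2 * (n * (n - 1) div 2) = n * (n - 1)" by (simp add: dvd_mult_div_cancel)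
  then have "(p\<^sup>2) powi (n * (n - 1) div 2) = p powi (n * (n - 1))"
    by (metis power_int_power of_nat_numeral)
  then show ?thesis by (simp add: theta_term_def)
qed

text \<open>Shift the summation index by \<open>k\<close>. Reindexing and extracting a constant are
  unconditional for \<open>infsum\<close>.\<close>

lemma jtheta_shift:
  assumes p: "p \<noteq> 0" and x: "x \<noteq> 0"
  shows "jtheta p (x * p powi k) = jtheta p x / theta_term p x k"
proof -
  have "theta_term p (x * p powi k) n = theta_term p x (n + k) / theta_term p x k" for n
    using p x theta_term_nonzero[OF p x, of k]
    by (simp add: theta_term_scale theta_term_add power_int_mult[symmetric] mult.commute)
  then have "jtheta p (x * p powi k) = (\<Sum>\<^sub>\<infinity>n. theta_term p x (n + k) / theta_term p x k)"
    unfolding jtheta_eq by (intro infsum_cong) simp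
  also have "\<dots> = (\<Sum>\<^sub>\<infinity>n. theta_term p x (n + k)) / theta_term p x k"
    by (simp add: divide_inverse infsum_cmult_left')
  also have "(\<Sum>\<^sub>\<infinity>n. theta_term p x (n + k)) = jtheta p x"
    unfolding jtheta_eq
    by (rule infsum_reindex_bij_witness[of _ "\<lambda>n. n - k" "\<lambda>n. n + k"]) auto
  finally show ?thesis .
qed

text \<open>The ratio test is run on each half of the integers, with ratios \<open>p ^ n * x\<close>
  upwards and \<open>p ^ Suc n / x\<close> downwards. Both halves contain 0, which is harmless for
  summability on the union.\<close>

lemma summable_norm_theta_term:
  assumes p: "0 < norm p" "norm p < 1" and x: "x \<noteq> 0"
  shows "(\<lambda>n. norm (theta_term p x n)) summable_on UNIV"
proof -
  have p': "p \<noteq> 0" using p by auto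
  have pow: "(\<lambda>n. p ^ n) \<longlonglongrightarrow> 0" using p by (intro LIMSEQ_power_zero)
  let ?f = "\<lambda>n. theta_term p x n"
  have "?f (int (Suc n)) = p ^ n * x * ?f (int n)" for n
    using theta_term_add[OF p' x, of "int n" 1] by (simp add: theta_term_def add.commute)
  moreover have "(\<lambda>n. p ^ n * x) \<longlonglongrightarrow> 0 * x" by (intro tendsto_intros pow)
  ultimately have "summable (\<lambda>n. norm (norm (?f (int n))))"
    using summable_norm_ratio[of "\<lambda>n. ?f (int n)" "\<lambda>n. p ^ n * x"] by simp
  then have nonneg: "(\<lambda>n. norm (?f n)) summable_on range int"
    using norm_summable_imp_summable_on[of "\<lambda>n. norm (?f (int n))"]
    by (subst summable_on_reindex) (auto simp: o_def)
  have "?f (- int (Suc n)) = p ^ Suc n / x * ?f (- int n)" for n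
    using theta_term_add[OF p' x, of "- int n" "-1"] x p'
    by (simp add: theta_term_def power_int_minus field_simps)
  moreover have "(\<lambda>n. p ^ Suc n / x) \<longlonglongrightarrow> 0 / x"
    using x by (intro tendsto_intros LIMSEQ_Suc[OF pow])
  ultimately have "summable (\<lambda>n. norm (norm (?f (- int n))))"
    using summable_norm_ratio[of "\<lambda>n. ?f (- int n)" "\<lambda>n. p ^ Suc n / x"] by simp
  then have neg: "(\<lambda>n. norm (?f n)) summable_on range (\<lambda>n. - int n)"
    using norm_summable_imp_summable_on[of "\<lambda>n. norm (?f (- int n))"]
    by (subst summable_on_reindex) (auto simp: o_def inj_def)
  have "n \<in> range int \<union> range (\<lambda>n. - int n)" for n
    by (cases n rule: int_cases2) auto
  then have "range int \<union> range (\<lambda>n. - int n) = UNIV" by blast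
  then show ?thesis
    using summable_on_union[OF nonneg neg] by simp
qed

lemma has_sum_theta_term:
  assumes "0 < norm p" "norm p < 1" "x \<noteq> 0"
  shows "(theta_term p x has_sum jtheta p x) UNIV"
  unfolding jtheta_eq
  by (rule has_sum_infsum) (rule abs_summable_summable[OF summable_norm_theta_term[OF assms]])

text \<open>The map \<open>(n, m)\<close> to \<open>(n + h m, m)\<close> is a bijection, so the
  absolutely summable product family and \<open>F\<close> have the same total. Summing
  \<open>F\<close> row by row gives \<open>r\<close>. The uses below take \<open>h m\<close> to be
  \<open>-m\<close>, \<open>m\<close> and \<open>m + 1\<close>.\<close>

lemma has_sum_sheared_product:
  fixes f :: "int \<Rightarrow> complex" and g :: "nat \<Rightarrow> complex" and h :: "nat \<Rightarrow> int"
  assumes f: "(\<lambda>n. norm (f n)) summable_on UNIV" "(f has_sum s) UNIV"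
    and g: "summable (\<lambda>m. norm (g m))" "g sums t"
    and eq: "\<And>n m. F (n + h m) m = f n * g m"
    and r: "\<And>n. (F n has_sum r n) UNIV"
  shows "(r has_sum s * t) UNIV"
proof -
  have gs: "(g has_sum t) UNIV"
    using g by (rule norm_summable_imp_has_sum)
  have gn: "(\<lambda>m. norm (g m)) summable_on UNIV"
    using g(1) by (intro norm_summable_imp_summable_on) simp
  let ?P = "\<lambda>(n, m). f n * g m"
  have "(\<lambda>z. norm (?P z)) summable_on UNIV \<times> UNIV"
  proof (rule summable_on_SigmaI)
    show "((\<lambda>m. norm (?P (n, m))) has_sum norm (f n) * infsum (\<lambda>m. norm (g m)) UNIV) UNIV" for n
      using has_sum_cmult_right[OF has_sum_infsum[OF gn]] by (simp add: norm_mult)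
    show "(\<lambda>n. norm (f n) * infsum (\<lambda>m. norm (g m)) UNIV) summable_on UNIV"
      using f(1) by (rule summable_on_cmult_left)
  qed auto
  then have "?P summable_on UNIV \<times> UNIV"
    by (rule abs_summable_summable)
  then have "(?P has_sum s * t) (UNIV \<times> UNIV)"
    using has_sum_cmult_right[OF gs] has_sum_cmult_left[OF f(2)]
    by (intro has_sum_SigmaI[where g = "\<lambda>n. f n * t"]) auto
  also have "?this \<longleftrightarrow> ((\<lambda>(n, m). F n m) has_sum s * t) (UNIV \<times> UNIV)"
    by (rule has_sum_reindex_bij_witness
        [of _ "\<lambda>(n, m). (n - h m, m)" "\<lambda>(n, m). (n + h m, m)"]) (auto simp: eq)
  finally show ?thesis
    by (rule has_sum_SigmaD) (use r in auto)
qed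

subsection \<open>Euler's expansions\<close>

lemma qpoch_0 [simp]: "qpoch a q 0 = 1"
  by (simp add: qpoch_def)

lemma qpoch_Suc: "qpoch a q (Suc n) = qpoch a q n * (1 - a * q ^ n)"
  by (simp add: qpoch_def)

lemma qpoch_zero_left [simp]: "qpoch 0 q n = 1"
  by (simp add: qpoch_def)

lemma qhyp_coeff_11:
  "qhyp_coeff [0] [b] p k = (-1) ^ k * p ^ (k * (k - 1) div 2) / (qpoch b p k * qpoch p p k)"
  by (simp add: qhyp_coeff_def qpochs_def)

lemma triangle_Suc: "Suc n * (Suc n - 1) div 2 = n * (n - 1) div 2 + n"
proof -
  have "Suc n * (Suc n - 1) = n * (n - 1) + n * 2" by (cases n) auto
  then show ?thesis by (simp only: div_mult_self1 zero_neq_numeral not_False_eq_True)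
qed

text \<open>The summand of Euler's series for \<open>E(z)\<close>.\<close>

definition euler_term :: "complex \<Rightarrow> complex \<Rightarrow> nat \<Rightarrow> complex" where
  "euler_term q z n = (-1) ^ n * q ^ (n * (n - 1) div 2) / qpoch q q n * z ^ n"

lemma euler_term_Suc:
  "euler_term q z (Suc n) = - (q ^ n) * z / (1 - q ^ Suc n) * euler_term q z n"
  unfolding euler_term_def triangle_Suc qpoch_Suc power_add by (simp add: mult_ac)

lemma euler_term_scale: "euler_term q (c * z) n = c ^ n * euler_term q z n"
  by (simp add: euler_term_def power_mult_distrib)

context
  fixes q :: complex
  assumes q0: "0 < norm q" and q1: "norm q < 1"
begin

lemma q_nonzero: "q \<noteq> 0"
  using q0 by auto

lemma power_q_tendsto_0: "(\<lambda>n. q ^ n) \<longlonglongrightarrow> 0"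
  using q1 by (rule LIMSEQ_power_zero)

lemma one_minus_q_power_nonzero: "1 - q ^ Suc n \<noteq> 0"
proof
  assume "1 - q ^ Suc n = 0"
  then have "norm (q ^ Suc n) = 1" by simp
  moreover have "norm (q ^ Suc n) < 1"
    unfolding norm_power using q0 q1 by (intro power_Suc_less_one) auto
  ultimately show False by simp
qed

lemma summable_norm_euler_term: "summable (\<lambda>n. norm (euler_term q z n))"
proof (rule summable_norm_ratio)
  show "(\<lambda>n. - (q ^ n) * z / (1 - q ^ Suc n)) \<longlonglongrightarrow> - 0 * z / (1 - 0)"
    by (intro tendsto_intros power_q_tendsto_0 LIMSEQ_Suc[OF power_q_tendsto_0]) auto
qed (use euler_term_Suc q_nonzero in auto)

lemma summable_euler_term: "summable (euler_term q z)"
  using summable_norm_euler_term by (rule summable_norm_cancel)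

text \<open>The factor \<open>1 - q ^ Suc n\<close>, produced by subtracting the terms at
  \<open>z\<close> and \<open>z * q\<close>, cancels the last factor of
  \<open>qpoch q q (Suc n)\<close>. What remains is the previous term at \<open>z * q\<close>, times
  \<open>-z\<close>.\<close>

lemma euler_series_functional:
  "suminf (euler_term q z) = (1 - z) * suminf (euler_term q (z * q))"
proof -
  let ?e = "\<lambda>w. suminf (euler_term q w)"
  have step: "euler_term q z (Suc n) - euler_term q (z * q) (Suc n)
      = - z * euler_term q (z * q) n" for n
  proof -
    have "euler_term q z (Suc n) - euler_term q (z * q) (Suc n)
        = (1 - q ^ Suc n) * euler_term q z (Suc n)"
      using euler_term_scale[of q q z "Suc n"] by (simp add: mult.commute algebra_simps)
    also have "\<dots> = - z * (q ^ n * euler_term q z n)"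
      using one_minus_q_power_nonzero[of n] by (simp add: euler_term_Suc)
    also have "q ^ n * euler_term q z n = euler_term q (z * q) n"
      using euler_term_scale[of q q z n] by (simp add: mult.commute)
    finally show ?thesis .
  qed
  have zero: "euler_term q w 0 = 1" for w by (simp add: euler_term_def)
  have "?e z - ?e (z * q) = (\<Sum>n. euler_term q z n - euler_term q (z * q) n)"
    by (rule suminf_diff[OF summable_euler_term summable_euler_term])
  also have "\<dots> = (\<Sum>n. euler_term q z (Suc n) - euler_term q (z * q) (Suc n))"
    using suminf_split_head[OF summable_diff[OF summable_euler_term[of z]
        summable_euler_term[of "z * q"]]]
    by (simp add: zero)
  also have "\<dots> = - z * ?e (z * q)"
    unfolding step by (rule suminf_mult[OF summable_euler_term])
  finally show ?thesis by (simp add: algebra_simps)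
qed

lemma euler_series_iterate:
  "suminf (euler_term q z) = qpoch z q n * suminf (euler_term q (z * q ^ n))"
proof (induction n)
  case (Suc n)
  then show ?case
    using euler_series_functional[of "z * q ^ n"]
    by (simp add: qpoch_Suc mult.assoc mult.commute mult.left_commute)
qed simp

lemma holomorphic_euler_series: "(\<lambda>z. suminf (euler_term q z)) holomorphic_on A"
proof -
  define F where "F = Abs_fps (\<lambda>n. (-1) ^ n * q ^ (n * (n - 1) div 2) / qpoch q q n)"
  have "fps_conv_radius F = \<infinity>"
    unfolding fps_conv_radius_def F_def
    using summable_euler_term
    by (intro conv_radius_inftyI'') (simp add: euler_term_def[abs_def])
  then have "eval_fps F holomorphic_on A"
    by (intro holomorphic_on_eval_fps) auto
  then show ?thesis
    by (simp add: eval_fps_def[abs_def] F_def euler_term_def[abs_def])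
qed

lemma euler_series_tendsto: "(\<lambda>n. suminf (euler_term q (z * q ^ n))) \<longlonglongrightarrow> 1"
proof -
  have "isCont (\<lambda>z. suminf (euler_term q z)) 0"
    using holomorphic_on_imp_continuous_on[OF holomorphic_euler_series[of UNIV]]
    by (simp add: continuous_on_eq_continuous_at)
  moreover have "(\<lambda>n. z * q ^ n) \<longlonglongrightarrow> 0"
    using tendsto_mult_right_zero[OF power_q_tendsto_0] .
  ultimately have "(\<lambda>n. suminf (euler_term q (z * q ^ n))) \<longlonglongrightarrow> suminf (euler_term q 0)"
    by (rule isCont_tendsto_compose)
  moreover have "suminf (euler_term q 0) = 1"
    using suminf_finite[of "{0}" "euler_term q 0"] by (simp add: euler_term_def)
  ultimately show ?thesis by simp
qed

text \<open>Iterating the functional equation writes the series as a finite product times a tail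
  that tends to 1. This yields convergence of the products as well as the value of
  \<open>lim\<close>.\<close>

lemma qpoch_inf_eq_euler_series: "qpoch_inf z q = suminf (euler_term q z)"
proof -
  let ?e = "\<lambda>n. suminf (euler_term q (z * q ^ n))"
  have "(\<lambda>n. suminf (euler_term q z) / ?e n) \<longlonglongrightarrow> suminf (euler_term q z) / 1"
    by (intro tendsto_intros euler_series_tendsto) auto
  \<comment> \<open>Only for large \<open>n\<close> is the tail known to be nonzero, so that it may
    be divided out.\<close>
  moreover have "\<forall>\<^sub>F n in sequentially. suminf (euler_term q z) / ?e n = qpoch z q n"
    using tendsto_imp_eventually_ne[OF euler_series_tendsto[of z], of 0, simplified]
  proof eventually_elim
    case (elim n)
    then show ?case using euler_series_iterate[of z n] by (simp add: field_simps)
  qed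
  ultimately have "(\<lambda>n. qpoch z q n) \<longlonglongrightarrow> suminf (euler_term q z)"
    by (simp add: tendsto_cong)
  then show ?thesis
    unfolding qpoch_inf_def by (rule limI)
qed

lemma has_sum_euler_term: "(euler_term q z has_sum qpoch_inf z q) UNIV"
  unfolding qpoch_inf_eq_euler_series
  by (intro norm_summable_imp_has_sum summable_norm_euler_term summable_sums summable_euler_term)

lemma holomorphic_qpoch_inf: "(\<lambda>z. qpoch_inf z q) holomorphic_on A"
  unfolding qpoch_inf_eq_euler_series by (rule holomorphic_euler_series)

lemma qpoch_inf_functional: "qpoch_inf z q = (1 - z) * qpoch_inf (z * q) q"
  unfolding qpoch_inf_eq_euler_series by (rule euler_series_functional)

text \<open>A far enough tail of the product is nonzero, so a zero must come from one of finitely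
  many factors.\<close>

lemma qpoch_inf_eq_0_iff: "qpoch_inf z q = 0 \<longleftrightarrow> (\<exists>n. z * q ^ n = 1)"
proof
  assume zero: "qpoch_inf z q = 0"
  have "\<forall>\<^sub>F n in sequentially. suminf (euler_term q (z * q ^ n)) \<noteq> 0"
    using euler_series_tendsto by (rule tendsto_imp_eventually_ne) auto
  then obtain n where "suminf (euler_term q (z * q ^ n)) \<noteq> 0"
    by (auto simp: eventually_sequentially)
  with zero euler_series_iterate[of z n] have "qpoch z q n = 0"
    by (simp add: qpoch_inf_eq_euler_series)
  then show "\<exists>n. z * q ^ n = 1"
    by (auto simp: qpoch_def)
next
  assume "\<exists>n. z * q ^ n = 1"
  then obtain n where "z * q ^ n = 1" ..
  then show "qpoch_inf z q = 0"
    \<comment> \<open>The finite product has to run to \<open>Suc n\<close> to contain the vanishing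
      factor with exponent \<open>n\<close>.\<close>
    using euler_series_iterate[of z "Suc n"] by (simp add: qpoch_inf_eq_euler_series qpoch_Suc)
qed

lemma qpoch_inf_q_nonzero: "qpoch_inf q q \<noteq> 0"
  using one_minus_q_power_nonzero by (auto simp: qpoch_inf_eq_0_iff)

section \<open>The power series of the reciprocal of \<open>E\<close>\<close>

lemma summable_norm_inverse_euler:
  assumes "norm z < 1"
  shows "summable (\<lambda>n. norm (z ^ n / qpoch q q n))"
proof (rule summable_norm_ratio)
  show "(\<lambda>n. z / (1 - q ^ Suc n)) \<longlonglongrightarrow> z / (1 - 0)"
    by (intro tendsto_intros power_q_tendsto_0 LIMSEQ_Suc[OF power_q_tendsto_0]) auto
qed (use assms in \<open>auto simp: qpoch_Suc\<close>)

text \<open>The series \<open>e\<close> satisfies \<open>e (w * q) = (1 - w) * e w\<close>, the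
  reciprocal of the equation for \<open>E\<close>. Hence \<open>e * E\<close> is constant along
  \<open>z * q ^ n\<close>, and its limit there is 1.\<close>

lemma inverse_euler_sums:
  assumes z: "norm z < 1"
  shows "(\<lambda>n. z ^ n / qpoch q q n) sums inverse (qpoch_inf z q)"
proof -
  define e where "e = (\<lambda>z. \<Sum>n. z ^ n / qpoch q q n)"
  have sm: "summable (\<lambda>n. w ^ n / qpoch q q n)" if "norm w < 1" for w
    using summable_norm_inverse_euler[OF that] by (rule summable_norm_cancel)
  have le: "norm (w * q ^ n) < 1" if "norm w < 1" for w n
  proof -
    have "norm q ^ n \<le> 1" using q1 by (intro power_le_one) auto
    then have "norm w * norm q ^ n \<le> norm w * 1" by (intro mult_left_mono) auto
    then show ?thesis using that by (simp add: norm_mult norm_power)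
  qed
  have fe: "e (w * q) = (1 - w) * e w" if w: "norm w < 1" for w
  proof -
    have wq: "norm (w * q) < 1" using le[OF w, of 1] by simp
    have step: "w ^ Suc n / qpoch q q (Suc n) - (w * q) ^ Suc n / qpoch q q (Suc n)
        = w * (w ^ n / qpoch q q n)" for n
    proof -
      have "w ^ Suc n / qpoch q q (Suc n) - (w * q) ^ Suc n / qpoch q q (Suc n)
          = w ^ Suc n * (1 - q ^ Suc n) / qpoch q q (Suc n)"
        by (simp only: power_mult_distrib diff_divide_distrib[symmetric] right_diff_distrib mult_1_right)
      also have "\<dots> = w * (w ^ n / qpoch q q n)"
        using one_minus_q_power_nonzero[of n] by (simp add: qpoch_Suc)
      finally show ?thesis .
    qed
    have "e w - e (w * q) = (\<Sum>n. w ^ n / qpoch q q n - (w * q) ^ n / qpoch q q n)"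
      unfolding e_def by (rule suminf_diff[OF sm[OF w] sm[OF wq]])
    also have "\<dots> = (\<Sum>n. w ^ Suc n / qpoch q q (Suc n) - (w * q) ^ Suc n / qpoch q q (Suc n))"
      using suminf_split_head[OF summable_diff[OF sm[OF w] sm[OF wq]]] by simp
    also have "\<dots> = w * e w"
      unfolding step e_def by (rule suminf_mult[OF sm[OF w]])
    finally show ?thesis by (simp add: algebra_simps)
  qed
  have const: "e (z * q ^ n) * qpoch_inf (z * q ^ n) q = e z * qpoch_inf z q" for n
  proof (induction n)
    case (Suc n)
    then show ?case
      using fe[OF le[OF z, of n]] qpoch_inf_functional[of "z * q ^ n"]
      by (simp add: mult.assoc mult.commute mult.left_commute)
  qed simp
  have "isCont (\<lambda>w. \<Sum>n. 1 / qpoch q q n * w ^ n) 0"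
  proof (rule isCont_powser)
    show "summable (\<lambda>n. 1 / qpoch q q n * (1 / 2) ^ n)" using sm[of "1/2"] by simp
  qed auto
  then have "isCont e 0" by (simp add: e_def)
  moreover have "(\<lambda>n. z * q ^ n) \<longlonglongrightarrow> 0"
    using tendsto_mult_right_zero[OF power_q_tendsto_0] .
  ultimately have "(\<lambda>n. e (z * q ^ n)) \<longlonglongrightarrow> e 0"
    by (rule isCont_tendsto_compose)
  moreover have "e 0 = 1"
    unfolding e_def using suminf_finite[of "{0}" "\<lambda>n. 0 ^ n / qpoch q q n"] by simp
  ultimately have "(\<lambda>n. e (z * q ^ n) * qpoch_inf (z * q ^ n) q) \<longlonglongrightarrow> 1 * 1"
    unfolding qpoch_inf_eq_euler_series by (intro tendsto_mult euler_series_tendsto) auto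
  then have "e z * qpoch_inf z q = 1"
    unfolding const by (simp add: LIMSEQ_const_iff)
  then have "e z = inverse (qpoch_inf z q)"
    by (metis inverse_unique mult.commute)
  then show ?thesis
    using summable_sums[OF sm[OF z]] by (simp add: e_def)
qed

subsection \<open>The Jacobi triple product\<close>

text \<open>The factor of the product with exponent \<open>- n - 1\<close>, which is nonnegative
  here, is \<open>1 - 1\<close>.\<close>

lemma qpoch_inf_q_powi_eq_0: "n < 0 \<Longrightarrow> qpoch_inf (q powi (n + 1)) q = 0"
proof -
  assume "n < 0"
  then have "q powi (n + 1) * q ^ nat (- n - 1) = q powi (n + 1 + (- n - 1))"
    using q_nonzero by (subst power_int_add) (auto simp: power_int_def)
  then have "q powi (n + 1) * q ^ nat (- n - 1) = 1" by simp
  then show ?thesis using qpoch_inf_eq_0_iff by blast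
qed

text \<open>Replaces \<open>1 / qpoch q q n\<close> in Euler's series by a value of \<open>E\<close>
  that makes sense for all integers \<open>n\<close>.\<close>

lemma qpoch_inf_q_power: "qpoch_inf (q ^ Suc n) q = qpoch_inf q q / qpoch q q n"
proof (induction n)
  case (Suc n)
  have "(1 - q ^ Suc n) * qpoch_inf (q ^ Suc (Suc n)) q = qpoch_inf q q / qpoch q q n"
    using qpoch_inf_functional[of "q ^ Suc n"] Suc.IH by (simp only: power_Suc2)
  then have "qpoch_inf (q ^ Suc (Suc n)) q = qpoch_inf q q / qpoch q q n / (1 - q ^ Suc n)"
    using one_minus_q_power_nonzero[of n] by (metis nonzero_mult_div_cancel_left)
  then show ?case by (simp only: qpoch_Suc power_Suc divide_divide_eq_left)
qed simp

text \<open>The terms with \<open>n < 0\<close> vanish, so this is Euler's series summed over all integers.\<close>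

lemma has_sum_theta_qpoch_inf:
  assumes a: "a \<noteq> 0"
  shows "((\<lambda>n. theta_term q (- a) n * qpoch_inf (q powi (n + 1)) q)
    has_sum qpoch_inf q q * qpoch_inf a q) UNIV"
proof -
  have "((\<lambda>n. qpoch_inf q q * euler_term q a n) has_sum qpoch_inf q q * qpoch_inf a q) UNIV"
    by (intro has_sum_cmult_right has_sum_euler_term)
  also have "(\<lambda>n. qpoch_inf q q * euler_term q a n)
    = (\<lambda>n. theta_term q (- a) (int n) * qpoch_inf (q powi (int n + 1)) q)"
  proof
    fix n
    have "int n * (int n - 1) div 2 = int (n * (n - 1) div 2)"
      by (rule triangle_int)
    then have "theta_term q (- a) (int n) = (-1) ^ n * q ^ (n * (n - 1) div 2) * a ^ n"
      by (simp add: theta_term_def power_minus[of a])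
    moreover have "qpoch_inf (q powi (int n + 1)) q = qpoch_inf q q / qpoch q q n"
      using qpoch_inf_q_power[of n] by (metis of_nat_Suc power_int_of_nat add.commute)
    ultimately show "qpoch_inf q q * euler_term q a n
        = theta_term q (- a) (int n) * qpoch_inf (q powi (int n + 1)) q"
      by (simp add: euler_term_def)
  qed
  also have "(\<dots> has_sum qpoch_inf q q * qpoch_inf a q) UNIV \<longleftrightarrow>
      ((\<lambda>n. theta_term q (- a) n * qpoch_inf (q powi (n + 1)) q)
        has_sum qpoch_inf q q * qpoch_inf a q) (range int)"
    by (subst has_sum_reindex) (auto simp: o_def)
  also have "\<dots> \<longleftrightarrow> ((\<lambda>n. theta_term q (- a) n * qpoch_inf (q powi (n + 1)) q)
        has_sum qpoch_inf q q * qpoch_inf a q) UNIV"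
  proof (rule has_sum_cong_neutral)
    fix n :: int assume "n \<in> UNIV - range int"
    then have "n < 0" by (metis DiffE nonneg_int_cases not_le rangeI)
    then show "theta_term q (- a) n * qpoch_inf (q powi (n + 1)) q = 0"
      by (simp add: qpoch_inf_q_powi_eq_0)
  qed auto
  finally show ?thesis .
qed

text \<open>The hypothesis makes the power series of \<open>1/E(q/a)\<close> converge. The sheared
  double series sums to \<open>jtheta q (- a)\<close> times this reciprocal, while its row sums have
  the total found in \<open>has_sum_theta_qpoch_inf\<close>.\<close>

lemma jacobi_triple_product_aux:
  assumes a: "norm q < norm a"
  shows "jtheta q (- a) = qpoch_inf q q * qpoch_inf a q * qpoch_inf (q / a) q"
proof -
  have a0: "a \<noteq> 0" using a q0 by auto
  have z: "norm (q / a) < 1" using a a0 by (simp add: norm_divide)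
  let ?F = "\<lambda>n m. theta_term q (- a) n * euler_term q (q powi (n + 1)) m"
  have eq: "?F (n + - int m) m = theta_term q (- a) n * ((q / a) ^ m / qpoch q q m)" for n m
  proof -
    let ?m = "int m"
    \<comment> \<open>With this identity the total exponent of \<open>q\<close> is
      \<open>m^2 - n m + (n - m + 1) m = m\<close>.\<close>
    have tri: "- ?m * (- ?m - 1) div 2 + ?m * (?m - 1) div 2 = ?m * ?m"
      using triangle_add[of "- ?m" ?m] by simp
    have "theta_term q (- a) (n + - ?m) = theta_term q (- a) n
        * (q powi (- ?m * (- ?m - 1) div 2) * (- a) powi (- ?m)) * q powi (n * - ?m)"
      using a0 q_nonzero by (subst theta_term_add) (auto simp: theta_term_def)
    moreover have "euler_term q (q powi (n + - ?m + 1)) m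
        = (-1) ^ m * q powi (?m * (?m - 1) div 2) / qpoch q q m * q powi ((n + - ?m + 1) * ?m)"
      unfolding euler_term_def power_int_power' triangle_int power_int_of_nat ..
    ultimately have "?F (n + - ?m) m = theta_term q (- a) n
        * ((-1) ^ m * (- a) powi (- ?m) / qpoch q q m)
        * (q powi (- ?m * (- ?m - 1) div 2) * q powi (?m * (?m - 1) div 2)
           * q powi (n * - ?m) * q powi ((n + - ?m + 1) * ?m))"
      by (simp only: mult_ac times_divide_eq_left times_divide_eq_right)
    also have "q powi (- ?m * (- ?m - 1) div 2) * q powi (?m * (?m - 1) div 2)
           * q powi (n * - ?m) * q powi ((n + - ?m + 1) * ?m)
        = q powi (- ?m * (- ?m - 1) div 2 + ?m * (?m - 1) div 2 + n * - ?m + (n + - ?m + 1) * ?m)"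
      using q_nonzero by (simp only: power_int_add simp_thms)
    also have "\<dots> = q ^ m"
      unfolding tri by (simp add: algebra_simps)
    also have "(-1) ^ m * (- a) powi (- ?m) = inverse a ^ m"
      by (simp add: power_int_minus power_minus[of a] power_inverse)
    finally show ?thesis by (simp add: divide_inverse power_mult_distrib mult_ac)
  qed
  have "((\<lambda>n. theta_term q (- a) n * qpoch_inf (q powi (n + 1)) q)
      has_sum jtheta q (- a) * inverse (qpoch_inf (q / a) q)) UNIV"
    by (rule has_sum_sheared_product[where F = ?F and h = "\<lambda>m. - int m"
          and f = "theta_term q (- a)" and g = "\<lambda>m. (q / a) ^ m / qpoch q q m"])
      (use a0 q0 q1 z eq in \<open>auto intro!: summable_norm_theta_term has_sum_theta_term
        summable_norm_inverse_euler inverse_euler_sums has_sum_cmult_right has_sum_euler_term\<close>)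
  with has_sum_theta_qpoch_inf[OF a0]
  have "qpoch_inf q q * qpoch_inf a q = jtheta q (- a) * inverse (qpoch_inf (q / a) q)"
    by (rule has_sum_unique)
  \<comment> \<open>Nonvanishing is needed to clear \<open>inverse\<close>. A zero would force
    \<open>norm (q / a) * norm q ^ n = 1\<close>, although the left side is below 1.\<close>
  moreover have "qpoch_inf (q / a) q \<noteq> 0"
  proof
    assume "qpoch_inf (q / a) q = 0"
    then obtain n where "q / a * q ^ n = 1"
      using qpoch_inf_eq_0_iff by blast
    then have "norm (q / a) * norm q ^ n = 1"
      by (metis norm_mult norm_one norm_power)
    moreover have "norm (q / a) * norm q ^ n \<le> norm (q / a) * 1"
      using q1 by (intro mult_left_mono power_le_one) auto
    ultimately show False using z by simp
  qed
  ultimately show ?thesis by (simp add: field_simps)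
qed

text \<open>Replacing \<open>a\<close> by \<open>a * q\<close> multiplies both sides by
  \<open>- 1 / a\<close>. Every nonzero \<open>a\<close> is reached in finitely many such steps from
  some \<open>b = a / q ^ n\<close> with \<open>norm q < norm b\<close>.\<close>

lemma jacobi_triple_product:
  assumes a: "a \<noteq> 0"
  shows "jtheta q (- a) = qpoch_inf q q * qpoch_inf a q * qpoch_inf (q / a) q"
proof -
  let ?P = "\<lambda>a. jtheta q (- a) = qpoch_inf q q * qpoch_inf a q * qpoch_inf (q / a) q"
  have step: "?P (a * q)" if a: "a \<noteq> 0" and P: "?P a" for a
  proof -
    have "jtheta q (- (a * q)) = jtheta q (- a) / - a"
      using jtheta_shift[OF q_nonzero, of "- a" 1] a by (simp add: theta_term_def)
    \<comment> \<open>The factor \<open>1 - a\<close> is kept in the numerator, so the step also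
      covers \<open>a = 1\<close>.\<close>
    also have "\<dots> = qpoch_inf q q * ((1 - a) / - a * qpoch_inf (a * q) q) * qpoch_inf (q / a) q"
      unfolding P using qpoch_inf_functional[of a] by simp
    also have "(1 - a) / - a * qpoch_inf (a * q) q = (1 - 1 / a) * qpoch_inf (a * q) q"
      using a by (simp add: field_simps)
    also have "qpoch_inf q q * \<dots> * qpoch_inf (q / a) q
        = qpoch_inf q q * qpoch_inf (a * q) q * ((1 - 1 / a) * qpoch_inf (1 / a * q) q)"
      by simp
    also have "(1 - 1 / a) * qpoch_inf (1 / a * q) q = qpoch_inf (q / (a * q)) q"
      using qpoch_inf_functional[of "1 / a"] q_nonzero by simp
    finally show ?thesis .
  qed
  have "(\<lambda>n. norm q ^ n) \<longlonglongrightarrow> 0"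
    using q1 by (intro LIMSEQ_power_zero) simp
  then have "\<forall>\<^sub>F n in sequentially. norm q ^ n < norm a / norm q"
    using a q0 by (intro order_tendstoD) auto
  then obtain n where n: "norm q ^ n < norm a / norm q"
    by (auto simp: eventually_sequentially)
  define b where "b = a / q ^ n"
  have b: "b \<noteq> 0" using a q_nonzero by (simp add: b_def)
  have "norm q < norm b"
    using n q0 by (simp add: b_def norm_divide norm_power field_simps)
  then have "?P b" by (rule jacobi_triple_product_aux)
  then have "?P (b * q ^ k)" for k
  proof (induction k)
    case (Suc k)
    then show ?case
      using step[of "b * q ^ k"] b q_nonzero by (simp add: mult_ac)
  qed simp
  from this[of n] show ?thesis using q_nonzero by (simp add: b_def)
qed

subsection \<open>The series \<open>\<^sub>1\<phi>\<^sub>1\<close>\<close>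

lemma summable_norm_qhyp_11: "summable (\<lambda>k. norm (qhyp_coeff [0] [b] q k * z ^ k))"
proof (rule summable_norm_ratio)
  \<comment> \<open>This holds for every \<open>b\<close>: if \<open>1 - b * q ^ k\<close> vanishes,
    division by zero makes both sides 0.\<close>
  show "qhyp_coeff [0] [b] q (Suc k) * z ^ Suc k
      = - (q ^ k) * z / ((1 - b * q ^ k) * (1 - q ^ Suc k)) * (qhyp_coeff [0] [b] q k * z ^ k)" for k
    unfolding qhyp_coeff_11 triangle_Suc qpoch_Suc power_add by (simp add: mult_ac)
  show "(\<lambda>k. - (q ^ k) * z / ((1 - b * q ^ k) * (1 - q ^ Suc k)))
      \<longlonglongrightarrow> - 0 * z / ((1 - b * 0) * (1 - 0))"
    by (intro tendsto_intros power_q_tendsto_0 LIMSEQ_Suc[OF power_q_tendsto_0]) auto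
qed auto

lemma qhyp_11_sums: "(\<lambda>k. qhyp_coeff [0] [b] q k * z ^ k) sums qhyp [0] [b] q z"
  unfolding qhyp_def by (rule summable_sums[OF summable_norm_cancel[OF summable_norm_qhyp_11]])

end

text \<open>Odd exponents form the first factor, even exponents the second. This produces the lower
  parameter \<open>q\<close> of the first \<open>qhyp\<close>.\<close>

lemma qpoch_even: "qpoch q q (2 * k) = qpoch q (q\<^sup>2) k * qpoch (q\<^sup>2) (q\<^sup>2) k"
  by (induction k) (simp_all add: qpoch_Suc power_mult power_mult_distrib power2_eq_square mult_ac)

text \<open>Once \<open>1 - q\<close> is split off, the odd exponents start at 3; hence the lower
  parameter \<open>q ^ 3\<close> and the factor \<open>1 / (1 - q)\<close> in the result.\<close>

lemma qpoch_odd: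
  "qpoch q q (Suc (2 * k)) = (1 - q) * qpoch (q ^ 3) (q\<^sup>2) k * qpoch (q\<^sup>2) (q\<^sup>2) k"
  by (induction k)
    (simp_all add: qpoch_Suc power_mult power_mult_distrib power2_eq_square power3_eq_cube mult_ac)

text \<open>The minus sign in the argument cancels the sign \<open>(-1) ^ k\<close> of the
  coefficient. It is applied with \<open>w / a^2\<close> for \<open>w\<close>, and
  \<open>e = 1\<close> for even or \<open>e = 2\<close> for odd Euler terms.\<close>

lemma qhyp_11_square_term:
  assumes "q \<noteq> 0"
  shows "qhyp_coeff [0] [b] (q\<^sup>2) k * (- (q powi e * w)) ^ k
    = q powi (int k * (int k - 1) + e * int k) * w ^ k / (qpoch b (q\<^sup>2) k * qpoch (q\<^sup>2) (q\<^sup>2) k)"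
proof -
  have "2 * (k * (k - 1) div 2) = k * (k - 1)" by (cases k) auto
  then have "(q\<^sup>2) ^ (k * (k - 1) div 2) = q powi (int k * (int k - 1))"
    by (metis power_mult triangle_double_int power_int_of_nat)
  moreover have "(- (q powi e * w)) ^ k = (-1) ^ k * (q powi (e * int k) * w ^ k)"
    by (simp add: power_minus[of "q powi e * w"] power_mult_distrib power_int_power')
  ultimately show ?thesis
    using assms by (simp add: qhyp_coeff_11 power_int_add mult_ac)
qed

section \<open>Even and odd terms of Euler's series\<close>

lemma euler_term_even:
  assumes "q \<noteq> 0"
  shows "euler_term q (q powi e / a) (2 * k)
    = q powi (int k * (2 * int k - 1) + e * (2 * int k)) / (qpoch q q (2 * k) * a ^ (2 * k))"
proof -
  have "int (2 * k * (2 * k - 1) div 2) = int k * (2 * int k - 1)"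
    unfolding triangle_int[symmetric] by simp
  then have "q ^ (2 * k * (2 * k - 1) div 2) = q powi (int k * (2 * int k - 1))"
    by (metis power_int_of_nat)
  then show ?thesis
    using assms by (simp add: euler_term_def power_divide power_int_power' power_int_add)
qed

lemma euler_term_odd:
  assumes "q \<noteq> 0"
  shows "euler_term q (q powi e / a) (Suc (2 * k))
    = - (q powi ((2 * int k + 1) * int k + e * (2 * int k + 1)))
      / (qpoch q q (Suc (2 * k)) * a ^ Suc (2 * k))"
proof -
  have "int (Suc (2 * k) * (Suc (2 * k) - 1) div 2) = (2 * int k + 1) * int k"
    unfolding triangle_int[symmetric] by (simp add: algebra_simps)
  then have "q ^ (Suc (2 * k) * (Suc (2 * k) - 1) div 2) = q powi ((2 * int k + 1) * int k)"
    by (metis power_int_of_nat)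
  moreover have "(q powi e / a) ^ Suc (2 * k) = q powi (e * (2 * int k + 1)) / a ^ Suc (2 * k)"
    by (simp only: power_divide power_int_power') (simp add: add.commute)
  moreover have "(-1 :: complex) ^ Suc (2 * k) = - 1" by simp
  ultimately show ?thesis
    unfolding euler_term_def using assms by (simp only: power_int_add simp_thms) simp
qed

subsection \<open>Summation of the Borel--Laplace transform\<close>

context
  fixes q :: complex
  assumes q0: "0 < norm q" and q1: "norm q < 1"
begin

lemma norm_square_bounds: "0 < norm (q\<^sup>2)" "norm (q\<^sup>2) < 1"
  using q0 q1 by (auto simp: norm_power power_less_one_iff abs_square_less_1)

text \<open>The two parities are summed separately because each needs its own shear.\<close>

lemma euler_even_odd_split:
  "((\<lambda>k. euler_term q z (2 * k)) has_sum (\<Sum>\<^sub>\<infinity>k. euler_term q z (2 * k))) UNIV"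
  "((\<lambda>k. euler_term q z (Suc (2 * k))) has_sum (\<Sum>\<^sub>\<infinity>k. euler_term q z (Suc (2 * k)))) UNIV"
  "qpoch_inf z q = (\<Sum>\<^sub>\<infinity>k. euler_term q z (2 * k)) + (\<Sum>\<^sub>\<infinity>k. euler_term q z (Suc (2 * k)))"
proof -
  let ?E = "range (\<lambda>k::nat. 2 * k)" and ?O = "range (\<lambda>k::nat. Suc (2 * k))"
  note sum = has_sum_euler_term[OF q0 q1, of z]
  have sm: "euler_term q z summable_on B" for B
    using summable_on_subset_banach[OF has_sum_imp_summable[OF sum]] by simp
  have "(\<lambda>k. euler_term q z (2 * k)) summable_on UNIV"
    using sm[of ?E] by (subst (asm) summable_on_reindex) (auto simp: inj_def o_def)
  then show e: "((\<lambda>k. euler_term q z (2 * k)) has_sum (\<Sum>\<^sub>\<infinity>k. euler_term q z (2 * k))) UNIV"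
    by (rule has_sum_infsum)
  have "(\<lambda>k. euler_term q z (Suc (2 * k))) summable_on UNIV"
    using sm[of ?O] by (subst (asm) summable_on_reindex) (auto simp: inj_def o_def)
  then show o: "((\<lambda>k. euler_term q z (Suc (2 * k))) has_sum
      (\<Sum>\<^sub>\<infinity>k. euler_term q z (Suc (2 * k)))) UNIV"
    by (rule has_sum_infsum)
  have "(euler_term q z has_sum (\<Sum>\<^sub>\<infinity>k. euler_term q z (2 * k))) ?E"
    using e by (subst has_sum_reindex) (auto simp: inj_def o_def)
  moreover have "(euler_term q z has_sum (\<Sum>\<^sub>\<infinity>k. euler_term q z (Suc (2 * k)))) ?O"
    using o by (subst has_sum_reindex) (auto simp: inj_def o_def)
  moreover have "?E \<inter> ?O = {}" by auto presburger
  moreover have "?E \<union> ?O = UNIV"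
  proof -
    have "n \<in> ?E \<union> ?O" for n
      by (cases "even n") (auto elim!: evenE oddE)
    then show ?thesis by blast
  qed
  ultimately have "(euler_term q z has_sum
      (\<Sum>\<^sub>\<infinity>k. euler_term q z (2 * k)) + (\<Sum>\<^sub>\<infinity>k. euler_term q z (Suc (2 * k)))) UNIV"
    using has_sum_Un_disjoint by metis
  with sum show "qpoch_inf z q
      = (\<Sum>\<^sub>\<infinity>k. euler_term q z (2 * k)) + (\<Sum>\<^sub>\<infinity>k. euler_term q z (Suc (2 * k)))"
    by (rule has_sum_unique)
qed

text \<open>Expanding \<open>E\<close> by Euler gives terms \<open>2 * k\<close> and
  \<open>Suc (2 * k)\<close>. Shifting \<open>n\<close> by \<open>k\<close> and by
  \<open>k + 1\<close> respectively completes the square and decouples the two indices.\<close>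

lemma has_sum_theta_square_qpoch_inf:
  assumes a: "a \<noteq> 0" and w: "w \<noteq> 0"
  shows "((\<lambda>n. theta_term (q\<^sup>2) w n * qpoch_inf (q powi (1 - n) / a) q) has_sum
    jtheta (q\<^sup>2) w * qhyp [0] [q] (q\<^sup>2) (- (q * (w / a\<^sup>2)))
    + jtheta (q\<^sup>2) (w * q)
      * (- (w / a) / (1 - q) * qhyp [0] [q ^ 3] (q\<^sup>2) (- (q\<^sup>2 * (w / a\<^sup>2))))) UNIV"
proof -
  have q: "q \<noteq> 0" using q0 by auto
  note sq = norm_square_bounds
  let ?t = "theta_term (q\<^sup>2)"
  let ?z = "\<lambda>n. q powi (1 - n) / a"
  let ?e = "\<lambda>n. \<Sum>\<^sub>\<infinity>k. euler_term q (?z n) (2 * k)"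
  let ?o = "\<lambda>n. \<Sum>\<^sub>\<infinity>k. euler_term q (?z n) (Suc (2 * k))"
  let ?g = "\<lambda>k. qhyp_coeff [0] [q] (q\<^sup>2) k * (- (q * (w / a\<^sup>2))) ^ k"
  let ?h = "\<lambda>k. - (w / a) / (1 - q) * (qhyp_coeff [0] [q ^ 3] (q\<^sup>2) k * (- (q\<^sup>2 * (w / a\<^sup>2))) ^ k)"
  have even: "?t w (n + int k) * euler_term q (?z (n + int k)) (2 * k) = ?t w n * ?g k" for n k
  proof -
    let ?A = "(n + int k) * (n + int k - 1)"
    let ?B = "int k * (2 * int k - 1) + (1 - (n + int k)) * (2 * int k)"
    \<comment> \<open>All mixed products of \<open>n\<close> and \<open>k\<close> cancel.\<close>
    have "?A + ?B = n * (n - 1) + (int k * (int k - 1) + 1 * int k)"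
      by (simp add: algebra_simps)
    then have exps: "q powi ?A * q powi ?B
        = q powi (n * (n - 1)) * q powi (int k * (int k - 1) + 1 * int k)"
      using q by (metis power_int_add)
    have "?t w (n + int k) * euler_term q (?z (n + int k)) (2 * k)
        = (q powi ?A * q powi ?B) * (w powi n * w ^ k) / (qpoch q q (2 * k) * a ^ (2 * k))"
      unfolding theta_term_square euler_term_even[OF q] using w by (simp add: power_int_add)
    also have "\<dots> = ?t w n * (q powi (int k * (int k - 1) + 1 * int k) * (w / a\<^sup>2) ^ k
        / (qpoch q (q\<^sup>2) k * qpoch (q\<^sup>2) (q\<^sup>2) k))"
      unfolding exps theta_term_square qpoch_even
      by (simp add: power_divide power_mult) (simp add: mult_ac)
    also have "\<dots> = ?t w n * ?g k"
      using qhyp_11_square_term[OF q, of q k 1 "w / a\<^sup>2"] by simp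
    finally show ?thesis .
  qed
  have odd: "?t w (n + int (Suc k)) * euler_term q (?z (n + int (Suc k))) (Suc (2 * k))
      = ?t (w * q) n * ?h k" for n k
  proof -
    let ?A = "(n + int (Suc k)) * (n + int (Suc k) - 1)"
    let ?B = "(2 * int k + 1) * int k + (1 - (n + int (Suc k))) * (2 * int k + 1)"
    \<comment> \<open>Again no mixed product is left, but one extra \<open>n\<close> survives; it
      turns the theta argument \<open>w\<close> into \<open>w * q\<close>.\<close>
    have "?A + ?B = n * (n - 1) + n + (int k * (int k - 1) + 2 * int k)"
      by (simp add: algebra_simps)
    then have exps: "q powi ?A * q powi ?B
        = q powi (n * (n - 1)) * q powi n * q powi (int k * (int k - 1) + 2 * int k)"
      using q by (metis power_int_add)
    have "w powi (n + int (Suc k)) = w powi n * w ^ Suc k"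
      using w by (metis power_int_add power_int_of_nat)
    then have "?t w (n + int (Suc k)) * euler_term q (?z (n + int (Suc k))) (Suc (2 * k))
        = - ((q powi ?A * q powi ?B) * (w powi n * w ^ Suc k)
          / (qpoch q q (Suc (2 * k)) * a ^ Suc (2 * k)))"
      unfolding theta_term_square euler_term_odd[OF q] by simp
    also have "\<dots> = ?t (w * q) n * (- (w / a) / (1 - q)
        * (q powi (int k * (int k - 1) + 2 * int k) * (w / a\<^sup>2) ^ k
        / (qpoch (q ^ 3) (q\<^sup>2) k * qpoch (q\<^sup>2) (q\<^sup>2) k)))"
      unfolding exps theta_term_square qpoch_odd
      by (simp add: power_divide power_mult power_int_mult_distrib) (simp add: mult_ac)
    also have "\<dots> = ?t (w * q) n * ?h k"
      using qhyp_11_square_term[OF q, of "q ^ 3" k 2 "w / a\<^sup>2"] by simp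
    finally show ?thesis .
  qed
  have "((\<lambda>n. ?t w n * ?e n) has_sum
      jtheta (q\<^sup>2) w * qhyp [0] [q] (q\<^sup>2) (- (q * (w / a\<^sup>2)))) UNIV"
  proof (rule has_sum_sheared_product)
    show "?t w (n + int k) * euler_term q (?z (n + int k)) (2 * k) = ?t w n * ?g k" for n k
      by (rule even)
    show "((\<lambda>k. ?t w n * euler_term q (?z n) (2 * k)) has_sum ?t w n * ?e n) UNIV" for n
      by (intro has_sum_cmult_right euler_even_odd_split)
  qed (use w sq in \<open>auto intro: summable_norm_theta_term has_sum_theta_term
      summable_norm_qhyp_11 qhyp_11_sums\<close>)
  moreover have "((\<lambda>n. ?t w n * ?o n) has_sum jtheta (q\<^sup>2) (w * q)
      * (- (w / a) / (1 - q) * qhyp [0] [q ^ 3] (q\<^sup>2) (- (q\<^sup>2 * (w / a\<^sup>2))))) UNIV"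
  proof (rule has_sum_sheared_product)
    show "?t w (n + int (Suc k)) * euler_term q (?z (n + int (Suc k))) (Suc (2 * k))
        = ?t (w * q) n * ?h k" for n k
      by (rule odd)
    show "((\<lambda>k. ?t w n * euler_term q (?z n) (Suc (2 * k))) has_sum ?t w n * ?o n) UNIV" for n
      by (intro has_sum_cmult_right euler_even_odd_split)
    show "summable (\<lambda>k. norm (?h k))"
      unfolding norm_mult[of "- (w / a) / (1 - q)"]
      by (intro summable_mult summable_norm_qhyp_11 sq)
    show "?h sums (- (w / a) / (1 - q) * qhyp [0] [q ^ 3] (q\<^sup>2) (- (q\<^sup>2 * (w / a\<^sup>2))))"
      by (intro sums_mult qhyp_11_sums sq)
  qed (use w q sq in \<open>auto intro: summable_norm_theta_term has_sum_theta_term\<close>)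
  ultimately show ?thesis
    unfolding euler_even_odd_split(3) distrib_left by (rule has_sum_add)
qed

text \<open>The reciprocal of an entire function is nicely meromorphic: the convention
  \<open>inverse 0 = 0\<close> agrees with the value 0 prescribed at poles. Its expansion at 0 is
  the reciprocal Euler series, valid for \<open>norm u < norm q\<close>.\<close>

lemma meromorphic_continuation_qborel:
  "meromorphic_continuation (qborel q (qhyp_fps [0, 0] [] q (- 1 / q)))
    = (\<lambda>\<xi>. inverse (qpoch_inf (\<xi> / q) q))"
proof (rule meromorphic_continuation_eqI)
  have q: "q \<noteq> 0" using q0 by auto
  have "(\<lambda>z. qpoch_inf z q) \<circ> (\<lambda>\<xi>. \<xi> / q) holomorphic_on UNIV"
    using q by (intro holomorphic_on_compose holomorphic_intros holomorphic_qpoch_inf q0 q1)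
  then have "(\<lambda>\<xi>. qpoch_inf (\<xi> / q) q) analytic_on UNIV"
    by (simp add: o_def analytic_on_open)
  then show "(\<lambda>\<xi>. inverse (qpoch_inf (\<xi> / q) q)) nicely_meromorphic_on UNIV"
    by (intro nicely_meromorphic_on_inverse analytic_on_imp_nicely_meromorphic_on)
  show "(\<lambda>\<xi>. inverse (qpoch_inf (\<xi> / q) q))
      has_fps_expansion qborel q (qhyp_fps [0, 0] [] q (- 1 / q))"
  proof (rule has_fps_expansionI)
    \<comment> \<open>The hypergeometric exponent is \<open>1 + 0 - 2 = -1\<close>, so the Borel
      factor cancels the power of \<open>q\<close>, and the sign cancels that of
      \<open>(- 1 / q) ^ n\<close>.\<close>
    have coeff: "fps_nth (qborel q (qhyp_fps [0, 0] [] q (- 1 / q))) n * u ^ n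
        = (u / q) ^ n / qpoch q q n" for n u
      using q
      by (cases "even n") (simp_all add: qborel_def qhyp_fps_def qhyp_coeff_def qpochs_def
          power_int_minus power_divide field_simps)
    have "\<forall>\<^sub>F u in nhds 0. u \<in> ball 0 (norm q)"
      using q0 by (intro eventually_nhds_in_open) auto
    then show "\<forall>\<^sub>F u in nhds 0. (\<lambda>n. fps_nth (qborel q (qhyp_fps [0, 0] [] q (- 1 / q))) n * u ^ n)
        sums inverse (qpoch_inf (u / q) q)"
    proof eventually_elim
      case (elim u)
      then show ?case
        unfolding coeff using q by (intro inverse_euler_sums q0 q1) (simp add: norm_divide)
    qed
  qed
qed

text \<open>The triple product at \<open>a * q powi n\<close> trades
  \<open>1/E(a * q powi n)\<close> for \<open>E(q powi (1 - n) / a)\<close> over a theta value. By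
  quasi-periodicity both theta values become constants times theta terms, which multiply to one term
  of base \<open>q^2\<close>.\<close>

lemma two_f_zero_eq:
  assumes l: "l \<noteq> 0" "l \<notin> qspiral 1 q" and x: "x \<noteq> 0"
  defines "a \<equiv> l / q" and "w \<equiv> - (l\<^sup>2 / (q * x))"
  shows "two_f_zero q l x = qpoch_inf q q / (jtheta q (- a) * jtheta q (l / x))
    * (\<Sum>\<^sub>\<infinity>n. theta_term (q\<^sup>2) w n * qpoch_inf (q powi (1 - n) / a) q)"
proof -
  have q: "q \<noteq> 0" using q0 by auto
  have a: "a \<noteq> 0" using l q by (simp add: a_def)
  have nz: "qpoch_inf (a * q powi n) q \<noteq> 0" "qpoch_inf (q / (a * q powi n)) q \<noteq> 0" for n
  proof -
    have not1: "a * q powi m \<noteq> 1" for m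
    proof
      assume "a * q powi m = 1"
      then have "l = q powi (1 - m)"
        using q by (simp add: a_def power_int_diff field_simps)
      then show False using l(2) by (auto simp: qspiral_def)
    qed
    show "qpoch_inf (a * q powi n) q \<noteq> 0"
    proof
      assume "qpoch_inf (a * q powi n) q = 0"
      then obtain k where "a * q powi n * q ^ k = 1"
        using qpoch_inf_eq_0_iff[OF q0 q1] by blast
      then show False
        using not1[of "n + int k"] q by (simp add: power_int_add mult.assoc)
    qed
    show "qpoch_inf (q / (a * q powi n)) q \<noteq> 0"
    proof
      assume "qpoch_inf (q / (a * q powi n)) q = 0"
      then obtain k where "q / (a * q powi n) * q ^ k = 1"
        using qpoch_inf_eq_0_iff[OF q0 q1] by blast
      \<comment> \<open>The numerator \<open>q\<close> contributes the extra 1 in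
        \<open>Suc k\<close>.\<close>
      then have "a * q powi (n - int (Suc k)) = 1"
        using q a power_int_add[of q 1 "int k"] by (simp add: power_int_diff field_simps)
      then show False using not1 by blast
    qed
  qed
  have inv: "inverse (qpoch_inf (a * q powi n) q)
      = qpoch_inf q q / jtheta q (- a) * theta_term q (- a) n * qpoch_inf (q powi (1 - n) / a) q" for n
  proof -
    have "qpoch_inf q q * qpoch_inf (a * q powi n) q * qpoch_inf (q / (a * q powi n)) q
        = jtheta q (- a) / theta_term q (- a) n"
      using jacobi_triple_product[OF q0 q1, of "a * q powi n"] jtheta_shift[OF q, of "- a" n] a q
      by simp
    moreover have "q / (a * q powi n) = q powi (1 - n) / a"
      using q by (simp add: power_int_diff)
    moreover have "theta_term q (- a) n \<noteq> 0"
      using q a by (simp add: theta_term_nonzero)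
    ultimately show ?thesis
      \<comment> \<open>As every factor on the left of the triple product is nonzero, so is
        \<open>jtheta q (- a)\<close>, and the division is legitimate.\<close>
      using nz[of n] qpoch_inf_q_nonzero[OF q0 q1] by (auto simp: field_simps)
  qed
  have "two_f_zero q l x
      = (\<Sum>\<^sub>\<infinity>n. inverse (qpoch_inf (l * q powi n / q) q) / jtheta q (l * q powi n / x))"
    unfolding two_f_zero_def qborel_laplace_def qlaplace_def meromorphic_continuation_qborel ..
  also have "\<dots> = (\<Sum>\<^sub>\<infinity>n. qpoch_inf q q / (jtheta q (- a) * jtheta q (l / x))
      * (theta_term (q\<^sup>2) w n * qpoch_inf (q powi (1 - n) / a) q))"
  proof (rule infsum_cong)
    fix n
    have "l * q powi n / q = a * q powi n" by (simp add: a_def)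
    moreover have "jtheta q (l * q powi n / x) = jtheta q (l / x) / theta_term q (l / x) n"
      using jtheta_shift[OF q, of "l / x" n] l x by simp
    moreover have "theta_term q (- a) n * theta_term q (l / x) n = theta_term (q\<^sup>2) w n"
    proof -
      have "- a * (l / x) = w" by (simp add: a_def w_def power2_eq_square)
      then show ?thesis using theta_term_mult[OF q, of "- a" n "l / x"] by simp
    qed
    ultimately show "inverse (qpoch_inf (l * q powi n / q) q) / jtheta q (l * q powi n / x)
      = qpoch_inf q q / (jtheta q (- a) * jtheta q (l / x))
      * (theta_term (q\<^sup>2) w n * qpoch_inf (q powi (1 - n) / a) q)"
      by (simp add: inv mult_ac)
  qed
  also have "\<dots> = qpoch_inf q q / (jtheta q (- a) * jtheta q (l / x))
      * (\<Sum>\<^sub>\<infinity>n. theta_term (q\<^sup>2) w n * qpoch_inf (q powi (1 - n) / a) q)"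
    by (rule infsum_cmult_right')
  finally show ?thesis .
qed

end

theorem theorem3:
  fixes q l x :: complex
  assumes "0 < norm q" and "norm q < 1"
    and "l \<noteq> 0" and "l \<notin> qspiral 1 q"
    and "x \<noteq> 0" and "x \<notin> qspiral (- l) q"
  shows "jtheta q x * two_f_zero q l x =
      qpoch_inf q q *
        (jtheta q x * jtheta (q^2) (- (l^2 / (q * x)))
          / (jtheta q (- (l / q)) * jtheta q (l / x))) *
        qhyp [0] [q] (q^2) (q^2 / x)
    + qpoch_inf q q / (1 - q) *
        (jtheta q x * jtheta (q^2) (- (l^2 / x))
          / (jtheta q (- (l / q)) * jtheta q (l / x))) *
        (l / x) *
        qhyp [0] [q^3] (q^2) (q^3 / x)"
proof -
  have q: "q \<noteq> 0" using assms(1) by auto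
  define a w where "a = l / q" and "w = - (l\<^sup>2 / (q * x))"
  have a: "a \<noteq> 0" and w: "w \<noteq> 0" using assms(3,5) q by (simp_all add: a_def w_def)
  \<comment> \<open>Here \<open>w / a^2 = - (q / x)\<close>, which gives the arguments of both
    \<open>qhyp\<close> series.\<close>
  have "- (q * (w / a\<^sup>2)) = q\<^sup>2 / x" "- (q\<^sup>2 * (w / a\<^sup>2)) = q ^ 3 / x" "- (w / a) = l / x"
    "w * q = - (l\<^sup>2 / x)"
    using q assms(3,5) by (simp_all add: a_def w_def field_simps power2_eq_square power3_eq_cube)
  then have "(\<Sum>\<^sub>\<infinity>n. theta_term (q\<^sup>2) w n * qpoch_inf (q powi (1 - n) / a) q)
      = jtheta (q\<^sup>2) w * qhyp [0] [q] (q\<^sup>2) (q\<^sup>2 / x)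
      + jtheta (q\<^sup>2) (- (l\<^sup>2 / x)) * (l / x / (1 - q) * qhyp [0] [q ^ 3] (q\<^sup>2) (q ^ 3 / x))"
    using infsumI[OF has_sum_theta_square_qpoch_inf[OF assms(1,2) a w]] by simp
  then have "two_f_zero q l x = qpoch_inf q q / (jtheta q (- a) * jtheta q (l / x))
      * (jtheta (q\<^sup>2) w * qhyp [0] [q] (q\<^sup>2) (q\<^sup>2 / x)
      + jtheta (q\<^sup>2) (- (l\<^sup>2 / x)) * (l / x / (1 - q) * qhyp [0] [q ^ 3] (q\<^sup>2) (q ^ 3 / x)))"
    using two_f_zero_eq[OF assms(1-5)] by (simp only: a_def w_def)
  then show ?thesis
    unfolding a_def w_def by (simp add: distrib_left mult_ac)
qed

end
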